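(* For any prime $\ell>2$, any $N\in\mathbb F_\ell^*$, and any distinct $a,b\in\mathbb F_\ell^*$, $$\left||U_{a,b}(N;\ell)|-\frac{3\ell}{4}\right|\le\frac{2\sqrt\ell+7}{4}.$$
   Context: For $a,b,N\in\mathbb F_\ell^*$, $H_a(N;\ell)=\{ax+Nx^{-1}:x\in\mathbb F_\ell^*\}\subseteq\mathbb F_\ell$ and $U_{a,b}(N;\ell)=H_a(N;\ell)\cup H_b(N;\ell)$. *)

theory Defs
  imports Complex_Main "HOL-Library.Cardinality" "HOL-Computational_Algebra.Primes"
begin

text \<open>
  The prime field with \<open>\<ell>\<close> elements is rendered as a field type \<open>'a\<close> with \<open>CARD('a) = \<ell>\<close> for a prime
  \<open>\<ell>\<close>. Such a field is unique up to isomorphism, so the parameter \<open>\<ell>\<close> of \<open>H_a(N; \<ell>)\<close> and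
  \<open>U_{a,b}(N; \<ell>)\<close> is carried by the type of the arguments.
\<close>

definition H_set :: "'a::field \<Rightarrow> 'a \<Rightarrow> 'a set" where
  "H_set a N = {a * x + N * inverse x | x. x \<noteq> 0}"

definition U_set :: "'a::field \<Rightarrow> 'a \<Rightarrow> 'a \<Rightarrow> 'a set" where
  "U_set a b N = H_set a N \<union> H_set b N"

end

theory Submission
  imports Defs "HOL-Computational_Algebra.Polynomial_Factorial"
begin

text \<open>
  An element \<open>t\<close> lies in \<open>H_a\<close> iff \<open>t\<^sup>2 - 4 a N\<close> is a square, so the complement of \<open>U_{a,b}\<close> consists
  of the \<open>t\<close> for which \<open>t\<^sup>2 - c\<close> and \<open>t\<^sup>2 - d\<close> are both nonsquares, where \<open>c = 4 a N\<close> and \<open>d = 4 b N\<close>.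
  Counting these with the quadratic character (\<open>card_both_nonsquare\<close>) leaves, apart from elementary
  sums and a small correction for the zeros of \<open>t\<^sup>2 - c\<close> and \<open>t\<^sup>2 - d\<close>, the sum of the character over
  \<open>f(u) = u (u - c) (u - d)\<close>. The error term is then the Hasse bound \<open>2 \<surd>q\<close> for the elliptic curve
  \<open>y\<^sup>2 = f(x)\<close>, with its exact constant (\<open>hasse_bound_full_two_torsion\<close>).

  The Hasse bound is obtained by Manin's elementary method, in a form that uses abscissas only. On the
  curve \<open>f(t) y\<^sup>2 = f(x)\<close> over the rational functions in \<open>t\<close>, add multiples of \<open>Q = (t, 1)\<close> to the
  Frobenius point \<open>P = (t\<^sup>q, f(t)\<^bsup>(q-1)/2\<^esup>)\<close>, and let \<open>h\<^sub>n\<close> be the degree of the numerator of the abscissa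
  of \<open>P + n Q\<close>. Then \<open>h\<^sub>n\<^sub>+\<^sub>1 + h\<^sub>n\<^sub>-\<^sub>1 = 2 h\<^sub>n + 2\<close> (\<open>other_neighbour\<close>), so \<open>h\<^sub>n = n\<^sup>2 + k n + q\<close> for some
  \<open>k\<close>. The cancellation in the abscissa of \<open>P + Q\<close> is governed by the values of the character on
  \<open>f\<close>, which bounds \<open>k\<close> by minus the character sum (\<open>root_count_bound\<close>); replacing \<open>Q\<close> by \<open>-Q\<close>
  changes the sign of the sum. Finally, \<open>h\<^sub>n \<ge> 0\<close> for all natural \<open>n\<close> limits the size of the sum.

  The chain is built from abscissas alone: those of \<open>P + Q\<close> and \<open>P - Q\<close> are the roots of a quadratic whose
  coefficients depend only on that of \<open>P\<close>, and the relation between neighbouring abscissas is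
  symmetric (\<open>linked_sym\<close>). So each next abscissa is the other root of the quadratic that already has the
  preceding abscissa as a root.
\<close>

section \<open>Coprime polynomials over a field\<close>

lemma not_coprime_poly_imp_common_prime:
  fixes p q :: "'a::field poly"
  assumes "\<not> coprime p q" "p \<noteq> 0"
  shows "\<exists>r. prime_elem r \<and> r dvd p \<and> r dvd q"
proof -
  define P where "P = (\<lambda>r. r dvd p \<and> r dvd q \<and> \<not> is_unit r)"
  obtain h where "P h"
    using assms by (auto simp: P_def elim: not_coprimeE)
  then obtain r where r: "P r" and least: "\<And>h. P h \<Longrightarrow> degree r \<le> degree h"
    by (metis ex_has_least_nat)
  have "r \<noteq> 0" using r assms(2) by (auto simp: P_def)
  have "irreducible r"
  proof (rule irreducibleI)
    fix x y assume xy: "r = x * y"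
    then have nz: "x \<noteq> 0" "y \<noteq> 0" using \<open>r \<noteq> 0\<close> by auto
    show "is_unit x \<or> is_unit y"
    proof (rule ccontr)
      assume "\<not> ?thesis"
      then have "P x" and pos: "degree y > 0"
        using r nz unfolding P_def xy by (auto simp: is_unit_iff_degree intro: dvd_mult_left)
      then show False using least[of x] nz by (simp add: xy degree_mult_eq)
    qed
  qed (use r \<open>r \<noteq> 0\<close> in \<open>auto simp: P_def\<close>)
  then show ?thesis using r field_poly_irreducible_imp_prime by (auto simp: P_def)
qed

lemma common_factor_poly:
  fixes p q :: "'a::field poly"
  assumes "q \<noteq> 0"
  shows "\<exists>g p' q'. p = g * p' \<and> q = g * q' \<and> coprime p' q'"
proof -
  define P where "P = (\<lambda>n. \<exists>g. g dvd p \<and> g dvd q \<and> degree g = n)"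
  have "P 0" unfolding P_def by (rule exI[of _ 1]) auto
  moreover have "\<forall>n. P n \<longrightarrow> n \<le> degree q"
    unfolding P_def using assms dvd_imp_degree_le by blast
  ultimately obtain n where n: "P n" "\<And>m. P m \<Longrightarrow> m \<le> n"
    by (metis GreatestI_nat Greatest_le_nat)
  then obtain g where g: "g dvd p" "g dvd q" "degree g = n" unfolding P_def by auto
  then obtain p' q' where p': "p = g * p'" "q = g * q'" by (auto elim!: dvdE)
  have "coprime p' q'"
  proof (rule coprimeI)
    fix h assume h: "h dvd p'" "h dvd q'"
    have nz: "g \<noteq> 0" "h \<noteq> 0" using assms p' h by auto
    have "P (degree (g * h))" unfolding P_def using h p' by (auto intro!: exI[of _ "g*h"])
    then have "degree (g * h) \<le> n" by (rule n)
    then have "degree h = 0" using nz g by (simp add: degree_mult_eq)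
    then show "is_unit h" using nz by (simp add: is_unit_iff_degree)
  qed
  then show ?thesis using p' by blast
qed

text \<open>
  A nonzero element of least degree in the ideal generated by \<open>p\<close> and \<open>q\<close> divides both of them,
  since otherwise a remainder would be a smaller element.
\<close>
lemma bezout_poly:
  fixes p q :: "'a::field poly"
  assumes "coprime p q"
  shows "\<exists>a b. a * p + b * q = 1"
proof -
  define I where "I = {a * p + b * q | a b. True}"
  have sub: "x - k * y \<in> I" if xy: "x \<in> I" "y \<in> I" for x y k
  proof -
    obtain a b a' b' where "x = a * p + b * q" "y = a' * p + b' * q"
      using xy unfolding I_def by auto
    then have "x - k * y = (a - k * a') * p + (b - k * b') * q" by (simp add: algebra_simps)
    then show ?thesis unfolding I_def by blast
  qed
  have "1 * p + 0 * q \<in> I" "0 * p + 1 * q \<in> I" unfolding I_def by blast+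
  then have pq: "p \<in> I" "q \<in> I" by auto
  have "p \<noteq> 0 \<or> q \<noteq> 0" using assms by auto
  then obtain k where k: "k \<in> I \<and> k \<noteq> 0" using pq by auto
  from ex_has_least_nat[of "\<lambda>r. r \<in> I \<and> r \<noteq> 0", OF k, of degree]
  obtain r where r: "r \<in> I" "r \<noteq> 0"
    and least: "\<And>s. s \<in> I \<Longrightarrow> s \<noteq> 0 \<Longrightarrow> degree r \<le> degree s"
    by auto
  have "r dvd s" if "s \<in> I" for s
  proof -
    have "s mod r \<in> I" using sub[OF that r(1), of "s div r"] by (simp add: minus_div_mult_eq_mod)
    then have "s mod r = 0" using least[of "s mod r"] degree_mod_less[OF r(2), of s] by force
    then show ?thesis by auto
  qed
  then have "r dvd 1" using pq assms by (auto intro: coprime_common_divisor)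
  then obtain k where k: "1 = r * k" by (auto elim: dvdE)
  obtain a b where "r = a * p + b * q" using r unfolding I_def by auto
  then have "(k * a) * p + (k * b) * q = 1" using k by (simp add: algebra_simps)
  then show ?thesis by blast
qed

lemma coprime_dvd_mult_polyD:
  fixes p q s :: "'a::field poly"
  assumes "coprime p q" "p dvd q * s"
  shows "p dvd s"
proof -
  obtain a b where "a * p + b * q = 1" using bezout_poly[OF assms(1)] by auto
  then have "s = (a * p + b * q) * s" by simp
  also have "\<dots> = p * (a * s) + b * (q * s)" by (simp add: algebra_simps)
  finally show ?thesis using assms(2) by (metis dvd_add dvd_mult dvd_triv_left)
qed

section \<open>Translates of a generic point of a twisted elliptic curve\<close>

text \<open>
  The conditions say that \<open>f = x (x - c) (x - d)\<close> has three distinct roots in a field of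
  characteristic other than 2, i.e. that \<open>y\<^sup>2 = f(x)\<close> is an elliptic curve all of whose 2-torsion is
  rational.
\<close>
locale full_two_torsion_cubic =
  fixes c d :: "'a::field"
  assumes two_nonzero: "(2::'a) \<noteq> 0"
    and c_nonzero: "c \<noteq> 0" and d_nonzero: "d \<noteq> 0" and c_neq_d: "c \<noteq> d"
begin

definition cubic :: "'a poly" where
  "cubic = [:0, 1:] * [:- c, 1:] * [:- d, 1:]"

text \<open>
  On the twisted curve \<open>f(t) y\<^sup>2 = f(x)\<close> over the rational functions in \<open>t\<close>, let \<open>Q = (t, 1)\<close> and let
  \<open>P\<close> be a point with abscissa \<open>F / G\<close>; here \<open>t\<close> is the polynomial \<open>[:0, 1:]\<close>, and \<open>G = 0\<close> stands for
  the point at infinity. The abscissas of \<open>P + Q\<close> and \<open>P - Q\<close> are the two roots \<open>Z\<close> of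
  \<open>sq_coeff \<cdot> Z\<^sup>2 - 2 \<cdot> mid_coeff \<cdot> Z + const_coeff = 0\<close>. These are the addition formulas after the
  ordinates have been eliminated.
\<close>
definition sq_coeff :: "'a poly \<Rightarrow> 'a poly \<Rightarrow> 'a poly" where
  "sq_coeff F G = (F - [:0, 1:] * G)\<^sup>2"

definition mid_coeff :: "'a poly \<Rightarrow> 'a poly \<Rightarrow> 'a poly" where
  "mid_coeff F G = (F + [:0, 1:] * G) * ([:0, 1:] * F + [:c:] * [:d:] * G)
     - 2 * ([:c:] + [:d:]) * [:0, 1:] * F * G"

definition const_coeff :: "'a poly \<Rightarrow> 'a poly \<Rightarrow> 'a poly" where
  "const_coeff F G = ([:0, 1:] * F - [:c:] * [:d:] * G)\<^sup>2"

definition linked :: "'a poly \<Rightarrow> 'a poly \<Rightarrow> 'a poly \<Rightarrow> 'a poly \<Rightarrow> bool" where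
  "linked F G F' G' \<longleftrightarrow>
     sq_coeff F G * F'\<^sup>2 + const_coeff F G * G'\<^sup>2 = 2 * mid_coeff F G * F' * G'"

text \<open>
  Abscissas of points that differ by \<open>Q\<close> should form a symmetric relation, and the equation is
  indeed symmetric: it is the same polynomial in \<open>(F, G)\<close> and in \<open>(F', G')\<close>. This is what allows the
  chain of translates to be continued by passing from one root of the quadratic to the other.
\<close>
lemma linked_sym:
  assumes "linked F G F' G'" shows "linked F' G' F G"
proof -
  define t where "t = [:0, 1::'a:]"
  define C where "C = [:c:]"
  define D where "D = [:d:]"
  have "sq_coeff F' G' * F\<^sup>2 + const_coeff F' G' * G\<^sup>2 - 2 * mid_coeff F' G' * F * G
      = sq_coeff F G * F'\<^sup>2 + const_coeff F G * G'\<^sup>2 - 2 * mid_coeff F G * F' * G'"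
    unfolding sq_coeff_def mid_coeff_def const_coeff_def
      t_def[symmetric] C_def[symmetric] D_def[symmetric]
    by (simp add: power2_eq_square algebra_simps)
  then show ?thesis using assms unfolding linked_def by simp
qed

text \<open>
  The quadratic is primitive. Modulo a common prime factor \<open>r\<close>, the outer coefficients force
  \<open>F = t G\<close> and \<open>t\<^sup>2 = c d\<close>, and then the middle one becomes \<open>4 G\<^sup>2 f(t)\<close>. So \<open>t\<close> is congruent to one
  of the roots \<open>0, c, d\<close> of \<open>f\<close>; as \<open>t\<^sup>2 = c d\<close> as well, two of these roots coincide.
\<close>
lemma no_common_prime_of_coeffs:
  assumes cop: "coprime F G" and r: "prime_elem r"
    and dvds: "r dvd sq_coeff F G" "r dvd const_coeff F G" "r dvd 2 * mid_coeff F G"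
  shows False
proof -
  define t where "t = [:0, 1::'a:]"
  define C where "C = [:c:]"
  define D where "D = [:d:]"
  note folds = t_def[symmetric] C_def[symmetric] D_def[symmetric]
  have cubic: "cubic = t * (t - C) * (t - D)" by (simp add: cubic_def t_def C_def D_def)
  have nu: "\<not> is_unit r" using r by auto
  have unit_const: False if "r dvd [:x:]" "x \<noteq> 0" for x
    using that nu by (metis dvd_trans dvd_field_iff is_unit_const_poly_iff)
  have u: "r dvd F - t * G"
    using dvds(1) r unfolding sq_coeff_def folds by (auto dest: prime_elem_dvd_power)
  have w: "r dvd t * F - C * D * G"
    using dvds(2) r unfolding const_coeff_def folds by (auto dest: prime_elem_dvd_power)
  have G: "\<not> r dvd G"
  proof
    assume "r dvd G"
    moreover from this have "r dvd (F - t * G) + t * G" using u by (intro dvd_add) auto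
    ultimately show False using cop nu by (auto dest: coprime_common_divisor)
  qed
  have "r dvd (t * F - C * D * G) - t * (F - t * G)" by (rule dvd_diff[OF w dvd_mult[OF u]])
  also have "\<dots> = (t * t - C * D) * G" by (simp add: algebra_simps)
  finally have tt: "r dvd t * t - C * D" using r G by (auto simp: prime_elem_dvd_mult_iff)
  \<comment> \<open>Dividing \<open>mid_coeff F G\<close> by \<open>F - t * G\<close> with remainder; the remainder is \<open>2 G\<^sup>2 f(t)\<close>.\<close>
  have "r dvd 2 * mid_coeff F G - (F - t * G) * (2 * (t*F + C*D*G + 2*t*t*G - 2*(C+D)*t*G))"
    using u dvds(3) by (intro dvd_diff) auto
  also have "\<dots> = (2 * 2) * (G * G * (t * (t - C) * (t - D)))"
    unfolding mid_coeff_def folds by (simp add: algebra_simps)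
  also have "\<dots> = [:2 * 2:] * (G * G * cubic)"
    unfolding cubic by (simp add: numeral_poly)
  finally have "r dvd [:2 * 2:] * (G * G * cubic)" .
  moreover have "\<not> r dvd [:2 * 2:]" using unit_const[of "2 * 2"] two_nonzero no_zero_divisors by blast
  ultimately have "r dvd cubic" using G r by (metis prime_elem_dvd_mult_iff)
  then have "r dvd t \<or> r dvd t - C \<or> r dvd t - D"
    using prime_elem_dvd_mult_iff[OF r] unfolding cubic by blast
  then show False
  proof (elim disjE)
    assume "r dvd t"
    then have "r dvd t * t - (t * t - C * D)" by (rule dvd_diff[OF dvd_mult tt])
    then have "r dvd [:d*c:]" by (simp add: C_def D_def)
    then show False using unit_const[of "d * c"] c_nonzero d_nonzero by simp
  next
    assume "r dvd t - C"
    then have "r dvd (t * t - C * D) - (t - C) * (t + C)" by (rule dvd_diff[OF tt dvd_mult2])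
    also have "\<dots> = C * (C - D)" by (simp add: algebra_simps)
    also have "\<dots> = [:c*(c-d):]" by (simp add: C_def D_def)
    finally show False using unit_const[of "c * (c - d)"] c_nonzero c_neq_d by simp
  next
    assume "r dvd t - D"
    then have "r dvd (t * t - C * D) - (t - D) * (t + D)" by (rule dvd_diff[OF tt dvd_mult2])
    also have "\<dots> = D * (D - C)" by (simp add: algebra_simps)
    also have "\<dots> = [:d*(d-c):]" by (simp add: C_def D_def)
    finally show False using unit_const[of "d * (d - c)"] d_nonzero c_neq_d by simp
  qed
qed


text \<open>
  For \<open>G \<noteq> 0\<close> this says \<open>degree G < degree F\<close>. The factor \<open>[:0, 1:]\<close> makes the condition cover
  \<open>G = 0\<close> too, where the convention \<open>degree 0 = 0\<close> would spoil the strict inequality.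
\<close>
definition pole_at_infinity :: "'a poly \<Rightarrow> 'a poly \<Rightarrow> bool" where
  "pole_at_infinity F G \<longleftrightarrow> F \<noteq> 0 \<and> degree ([:0, 1:] * G) \<le> degree F"

lemma degree_coeffs:
  assumes "pole_at_infinity F G"
  shows "degree (sq_coeff F G) \<le> 2 * degree F"
    and "degree (mid_coeff F G) \<le> 2 * degree F + 1"
    and "degree (const_coeff F G) = 2 * degree F + 2"
proof -
  define t where "t = [:0, 1::'a:]"
  have F: "F \<noteq> 0" and tG: "degree (t * G) \<le> degree F"
    using assms by (auto simp: pole_at_infinity_def t_def)
  have G: "degree G \<le> degree F"
    using tG by (cases "G = 0") (auto simp: t_def)
  have G': "G = 0 \<or> degree G < degree F"
    using tG by (cases "G = 0") (auto simp: t_def)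
  have tF: "degree (t * F) = degree F + 1" using F by (simp add: t_def)
  have bG: "degree ([:c:] * [:d:] * G) \<le> degree F"
    using G by (intro order.trans[OF degree_mult_le]) auto
  show "degree (sq_coeff F G) \<le> 2 * degree F"
    unfolding sq_coeff_def t_def[symmetric]
    by (rule order.trans[OF degree_power_le]) (use tG in \<open>auto intro!: degree_diff_le\<close>)
  have "degree (t * F - [:c:] * [:d:] * G) = degree F + 1"
    using tF bG degree_add_eq_left[of "- ([:c:] * [:d:] * G)" "t * F"] by simp
  moreover from this have "t * F - [:c:] * [:d:] * G \<noteq> 0" by auto
  ultimately show "degree (const_coeff F G) = 2 * degree F + 2"
    unfolding const_coeff_def t_def[symmetric] by (simp add: degree_power_eq)
  have "degree ((F + t * G) * (t * F + [:c:] * [:d:] * G)) \<le> degree F + (degree F + 1)"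
    using tF bG tG
    by (intro order.trans[OF degree_mult_le[of "F + t * G"]] add_mono degree_add_le) auto
  moreover have "degree (2 * ([:c:] + [:d:]) * t * F * G) \<le> degree F + (degree F + 1)"
  proof -
    have "2 * ([:c:] + [:d:]) * t * F * G = [:2 * (c + d):] * (F * (t * G))"
      by (simp add: numeral_poly algebra_simps)
    also have "degree \<dots> \<le> 0 + degree (F * (t * G))"
      by (rule order.trans[OF degree_mult_le]) simp
    also have "degree (F * (t * G)) \<le> degree F + degree (t * G)" by (rule degree_mult_le)
    finally show ?thesis using tG by simp
  qed
  ultimately show "degree (mid_coeff F G) \<le> 2 * degree F + 1"
    unfolding mid_coeff_def t_def[symmetric] by (intro degree_diff_le) auto
qed

text \<open>
  Because of \<open>degree_coeffs\<close>, the constant coefficient of the quadratic dominates at infinity: an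
  abscissa \<open>F' / G'\<close> that stays bounded there cannot be a root.
\<close>
lemma linked_pole_at_infinity:
  assumes pole: "pole_at_infinity F G" and link: "linked F G F' G'" and nz: "F' \<noteq> 0 \<or> G' \<noteq> 0"
  shows "pole_at_infinity F' G'"
proof (cases "G' = 0")
  case False
  have "degree F' > degree G'"
  proof (rule ccontr)
    assume "\<not> ?thesis"
    then have le: "degree F' \<le> degree G'" by simp
    have "degree (const_coeff F G * G'\<^sup>2) = 2 * degree F + 2 + 2 * degree G'"
      using False degree_coeffs(3)[OF pole]
      by (subst degree_mult_eq) (auto simp: degree_power_eq)
    moreover have "const_coeff F G * G'\<^sup>2 = [:2:] * mid_coeff F G * F' * G' - sq_coeff F G * F'\<^sup>2"
      using link by (simp add: linked_def numeral_poly algebra_simps)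
    moreover have "degree ([:2:] * mid_coeff F G * F' * G')
        \<le> 0 + (2 * degree F + 1) + degree G' + degree G'"
      using le degree_coeffs(2)[OF pole]
      by (intro order.trans[OF degree_mult_le] add_mono) auto
    moreover have "degree (sq_coeff F G * F'\<^sup>2) \<le> 2 * degree F + degree G' * 2"
      using le degree_coeffs(1)[OF pole]
      by (intro order.trans[OF degree_mult_le] add_mono order.trans[OF degree_power_le]) auto
    ultimately have "2 * degree F + 2 + 2 * degree G' \<le> 2 * degree F + 1 + 2 * degree G'"
      using degree_diff_le[of "[:2:] * mid_coeff F G * F' * G'" "2 * degree F + 1 + 2 * degree G'" "sq_coeff F G * F'\<^sup>2"]
      by simp
    then show False by simp
  qed
  then show ?thesis using False by (auto simp: pole_at_infinity_def)
qed (use nz in \<open>auto simp: pole_at_infinity_def\<close>)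

text \<open>
  One root \<open>F' / G'\<close> of the primitive quadratic splits it, by Gauss's lemma, into
  \<open>(G' Z - F') (G'' Z - F'')\<close>. No cancellation can happen, so the constant coefficient is exactly
  \<open>F' F''\<close>, and comparing degrees gives the parallelogram law for the degree,
  which is a height on this curve.
\<close>
lemma other_neighbour:
  assumes cop: "coprime F G" and pole: "pole_at_infinity F G"
    and cop': "coprime F' G'" and link: "linked F G F' G'"
  shows "\<exists>F'' G''. coprime F'' G'' \<and> linked F G F'' G'' \<and>
           degree F' + degree F'' = 2 * degree F + 2"
proof -
  define \<alpha> where "\<alpha> = sq_coeff F G"
  define \<beta> where "\<beta> = 2 * mid_coeff F G"
  define \<gamma> where "\<gamma> = const_coeff F G"
  have eq: "\<alpha> * F'\<^sup>2 + \<gamma> * G'\<^sup>2 = \<beta> * F' * G'" using link by (simp add: linked_def \<alpha>_def \<beta>_def \<gamma>_def)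
  have F': "F' \<noteq> 0"
    using linked_pole_at_infinity[OF pole link] cop' by (force simp: pole_at_infinity_def)
  have \<gamma>: "\<gamma> \<noteq> 0" using degree_coeffs(3)[OF pole] by (auto simp: \<gamma>_def)
  have "F' * (F' * \<alpha>) = G' * (\<beta> * F' - \<gamma> * G')"
    using eq by (simp add: power2_eq_square algebra_simps)
  then have "G' dvd F' * (F' * \<alpha>)" by simp
  then have G'\<alpha>: "G' dvd \<alpha>" using cop' by (metis coprime_dvd_mult_polyD coprime_commute)
  have "G' * (G' * \<gamma>) = F' * (\<beta> * G' - \<alpha> * F')"
    using eq by (simp add: power2_eq_square algebra_simps)
  then have "F' dvd G' * (G' * \<gamma>)" by simp
  then have "F' dvd \<gamma>" using cop' by (metis coprime_dvd_mult_polyD)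
  then obtain F'' where F'': "\<gamma> = F' * F''" by (auto elim: dvdE)
  obtain G'' where G'': "\<alpha> = G' * G''" "\<beta> = F' * G'' + F'' * G'"
  proof (cases "G' = 0")
    case True
    then have "is_unit F'" using cop' by simp
    then obtain G'' where "\<beta> = F' * G''" by (meson dvdE unit_imp_dvd)
    moreover have "\<alpha> = 0" using eq True F' by simp
    ultimately show ?thesis using True that by auto
  next
    case False
    obtain G'' where G'': "\<alpha> = G' * G''" using G'\<alpha> by (auto elim: dvdE)
    have "(F' * G') * \<beta> = (F' * G') * (F' * G'' + F'' * G')"
      using eq unfolding F'' G'' by (simp add: power2_eq_square algebra_simps)
    then have "\<beta> = F' * G'' + F'' * G'" using False F' by simp
    then show ?thesis using G'' that by auto
  qed
  have "coprime F'' G''"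
  proof (rule ccontr)
    assume "\<not> ?thesis"
    moreover have "F'' \<noteq> 0" using \<gamma> F'' by auto
    ultimately obtain r where r: "prime_elem r" "r dvd F''" "r dvd G''"
      using not_coprime_poly_imp_common_prime by blast
    then have "r dvd \<alpha>" "r dvd \<gamma>" "r dvd \<beta>" unfolding F'' G'' by auto
    then show False
      using no_common_prime_of_coeffs[OF cop r(1)] by (simp add: \<alpha>_def \<beta>_def \<gamma>_def)
  qed
  moreover have "\<alpha> * F''\<^sup>2 + \<gamma> * G''\<^sup>2 = \<beta> * F'' * G''"
    unfolding F'' G'' by (simp add: power2_eq_square algebra_simps)
  then have "linked F G F'' G''" by (simp add: linked_def \<alpha>_def \<beta>_def \<gamma>_def)
  moreover have "degree F' + degree F'' = 2 * degree F + 2"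
  proof -
    have "degree \<gamma> = degree F' + degree F''"
      using \<gamma> unfolding F'' by (intro degree_mult_eq) auto
    then show ?thesis using degree_coeffs(3)[OF pole] by (simp add: \<gamma>_def)
  qed
  ultimately show ?thesis by blast
qed

text \<open>
  Along the chain \<open>P, P + Q, P + 2 Q, \<dots>\<close> the parallelogram law fixes the second difference of the
  degrees to be 2, so they are the values of a monic quadratic polynomial in \<open>n\<close>. Degrees are
  nonnegative.
\<close>
lemma degree_quadratic_nonneg:
  fixes n :: nat
  assumes "coprime F\<^sub>0 G\<^sub>0" "pole_at_infinity F\<^sub>0 G\<^sub>0" "coprime F\<^sub>1 G\<^sub>1" "linked F\<^sub>0 G\<^sub>0 F\<^sub>1 G\<^sub>1"
  shows "0 \<le> int n * int n + (int (degree F\<^sub>1) - int (degree F\<^sub>0) - 1) * int n + int (degree F\<^sub>0)"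
proof -
  define Q where "Q = (\<lambda>n. int n * int n + (int (degree F\<^sub>1) - int (degree F\<^sub>0) - 1) * int n
                            + int (degree F\<^sub>0))"
  have "\<exists>F G F' G'. coprime F G \<and> pole_at_infinity F G \<and> coprime F' G' \<and> linked F G F' G'
          \<and> int (degree F) = Q n \<and> int (degree F') = Q (Suc n)"
  proof (induction n)
    case 0
    have "int (degree F\<^sub>0) = Q 0" "int (degree F\<^sub>1) = Q (Suc 0)" by (simp_all add: Q_def)
    then show ?case using assms by blast
  next
    case (Suc n)
    then obtain F G F' G' where IH: "coprime F G" "pole_at_infinity F G" "coprime F' G'"
      "linked F G F' G'" "int (degree F) = Q n" "int (degree F') = Q (Suc n)" by blast
    have "F' \<noteq> 0 \<or> G' \<noteq> 0" using IH(3) by auto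
    then have pole': "pole_at_infinity F' G'" using linked_pole_at_infinity IH by blast
    obtain F'' G'' where *: "coprime F'' G''" "linked F' G' F'' G''"
      "degree F + degree F'' = 2 * degree F' + 2"
      using other_neighbour[OF IH(3) pole' IH(1) linked_sym[OF IH(4)]] by blast
    have "int (degree F'') = 2 * Q (Suc n) + 2 - Q n" using *(3) IH(5,6) by linarith
    also have "\<dots> = Q (Suc (Suc n))" by (simp add: Q_def algebra_simps)
    finally show ?case using * IH pole' by blast
  qed
  then show ?thesis unfolding Q_def by (metis of_nat_0_le_iff)
qed

end

section \<open>The Frobenius point over a finite field\<close>

lemma finite_field_power_card_minus_one:
  fixes x :: "'a::{field,finite}"
  assumes "x \<noteq> 0"
  shows "x ^ (CARD('a) - 1) = 1"
proof -
  have "bij_betw ((*) x) (- {0}) (- {0})"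
    using assms by (intro bij_betw_byWitness[where f' = "\<lambda>y. y / x"]) auto
  then have "\<Prod>(- {0}) = (\<Prod>y\<in>- {0}. x * y)"
    by (simp add: prod.reindex_bij_betw[where g = "\<lambda>y. y"])
  also have "\<dots> = x ^ (CARD('a) - 1) * \<Prod>(- {0})"
    by (simp add: prod.distrib card_Diff_singleton Compl_eq_Diff_UNIV)
  finally show ?thesis by simp
qed

lemma finite_field_power_card:
  fixes x :: "'a::{field,finite}"
  shows "x ^ CARD('a) = x"
  using finite_field_power_card_minus_one[of x]
  by (cases "x = 0") (simp_all add: power_eq_if)

text \<open>
  Translation by 1 permutes the field, so the sum of all elements equals itself plus the cardinality;
  hence the cardinality vanishes in the field.
\<close>
lemma two_neq_zero_of_odd_card:
  assumes "odd CARD('a::{field,finite})"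
  shows "(2::'a) \<noteq> 0"
proof
  assume "(2::'a) = 0"
  then have "of_nat CARD('a) = (1::'a)"
    using assms by (auto elim!: oddE)
  moreover have "bij (\<lambda>x::'a. x + 1)" by (intro bijI') (auto intro: exI[of _ "_ - 1"])
  then have "(\<Sum>x::'a\<in>UNIV. x) = (\<Sum>x\<in>UNIV. x + 1)"
    by (simp add: sum.reindex_bij_betw[where g = "\<lambda>x. x"])
  then have "of_nat CARD('a) = (0::'a)" by (simp add: sum.distrib)
  ultimately show False by simp
qed

lemma prod_linear_factors_dvd:
  fixes p :: "'a::field poly"
  assumes "finite A" "\<And>a. a \<in> A \<Longrightarrow> poly p a = 0"
  shows "(\<Prod>a\<in>A. [:- a, 1:]) dvd p"
  using assms
proof (induction A arbitrary: p rule: finite_induct)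
  case (insert a A)
  then obtain q where q: "p = [:- a, 1:] * q"
    by (metis dvdE insertI1 poly_eq_0_iff_dvd)
  have "poly q b = 0" if "b \<in> A" for b
    using insert.prems[of b] insert.hyps that unfolding q by auto
  then have "(\<Prod>a\<in>A. [:- a, 1:]) dvd q" by (rule insert.IH)
  then show ?case unfolding q using insert.hyps by (simp add: mult_dvd_mono del: mult_pCons_left)
qed simp

lemma degree_prod_linear_factors:
  "degree (\<Prod>a\<in>A. [:- a, 1:] :: 'a::field poly) = card A"
  by (subst degree_prod_eq_sum_degree) auto

text \<open>
  Both sides are monic of degree \<open>CARD('a)\<close> and agree at all elements of the field.
\<close>
lemma shift_power_card:
  fixes c :: "'a::{field,finite}"
  assumes "odd CARD('a)"
  shows "([:0, 1:] - [:c:]) ^ CARD('a) = [:0, 1:] ^ CARD('a) - [:c:]"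
proof (rule poly_eqI_degree_lead_coeff[where A = UNIV and n = "CARD('a)"])
  show "poly (([:0, 1:] - [:c:]) ^ CARD('a)) z = poly ([:0, 1:] ^ CARD('a) - [:c:]) z" if "z \<in> UNIV" for z
    by (simp add: finite_field_power_card)
  have *: "degree ([:- a, 1:] ^ CARD('a)) = CARD('a)" for a :: 'a by (simp add: degree_power_eq)
  have lead: "coeff ([:- a, 1:] ^ CARD('a)) CARD('a) = 1" for a :: 'a
    using lead_coeff_power[of "[:- a, 1:]" "CARD('a)"] by (simp add: *)
  have eq: "[:0, 1:] - [:c:] = [:- c, 1:]" by simp
  show "degree (([:0, 1:] - [:c:]) ^ CARD('a)) \<le> CARD('a)" unfolding eq by (simp add: *)
  show "degree ([:0, 1:] ^ CARD('a) - [:c:]) \<le> CARD('a)" using *[of 0] by (intro degree_diff_le) auto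
  have "coeff [:c:] CARD('a) = 0" by (simp add: coeff_pCons split: nat.split)
  then show "coeff (([:0, 1:] - [:c:]) ^ CARD('a)) CARD('a) = coeff ([:0, 1:] ^ CARD('a) - [:c:]) CARD('a)"
    unfolding eq using lead[of c] lead[of 0] by simp
qed simp

locale cubic_over_finite_field = full_two_torsion_cubic c d
  for c d :: "'a::{field,finite}" +
  fixes m :: nat
  assumes card_eq: "CARD('a) = 2 * m + 1"
begin

lemma cubic_power_card:
  "cubic ^ CARD('a) = [:0, 1:] ^ CARD('a) * ([:0, 1:] ^ CARD('a) - [:c:]) * ([:0, 1:] ^ CARD('a) - [:d:])"
proof -
  have "odd CARD('a)" by (simp add: card_eq)
  have "cubic = [:0, 1:] * ([:0, 1:] - [:c:]) * ([:0, 1:] - [:d:])" by (simp add: cubic_def)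
  then show ?thesis by (simp only: power_mult_distrib shift_power_card[OF \<open>odd CARD('a)\<close>])
qed

text \<open>
  The chain starts at the Frobenius point \<open>(t\<^sup>q, f(t)\<^sup>m)\<close> with \<open>q = 2 m + 1\<close>, which lies on the twisted
  curve because \<open>f(t)\<^sup>q = f(t\<^sup>q)\<close>. For \<open>e = 1\<close> and \<open>e = -1\<close>, the fraction with numerator \<open>R\<close> and
  denominator \<open>(t\<^sup>q - t)\<^sup>2\<close> is the abscissa of its sum and of its difference with \<open>Q\<close>. The first form of
  \<open>R\<close> shows its degree, the second one, from the chord construction, its common factors with the
  denominator.
\<close>
lemma first_neighbour:
  fixes e :: 'a
  assumes e: "e\<^sup>2 = 1"
  defines "F \<equiv> [:0, 1:] ^ CARD('a)"
  defines "R \<equiv> mid_coeff F 1 - 2 * [:e:] * cubic ^ (m + 1)"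
  shows "linked F 1 R (sq_coeff F 1)"
    and "R = cubic * (cubic ^ m - [:e:])\<^sup>2 - (F + [:0, 1:] - [:c:] - [:d:]) * sq_coeff F 1"
proof -
  define t where "t = [:0, 1::'a:]"
  define C where "C = [:c:]"
  define D where "D = [:d:]"
  define E where "E = [:e:]"
  define g where "g = cubic ^ m"
  note folds = t_def[symmetric] C_def[symmetric] D_def[symmetric] E_def[symmetric]
  have E: "E * E = 1" using e by (simp add: E_def power2_eq_square one_pCons)
  have cub: "cubic = t * (t - C) * (t - D)" by (simp add: cubic_def t_def C_def D_def)
  have R: "R = mid_coeff F 1 - 2 * E * (cubic * g)"
    by (simp add: R_def g_def E_def)
  have "cubic * (g * g) = cubic ^ CARD('a)" by (simp add: g_def card_eq mult_2 power_add)
  then have g2: "cubic * (g * g) = F * (F - C) * (F - D)"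
    using cubic_power_card by (simp add: F_def C_def D_def)
  \<comment> \<open>A quarter of the discriminant of the quadratic is \<open>4 f(t) f(t\<^sup>q) = 4 f(t)\<^bsup>q+1\<^esup>\<close>, a square.\<close>
  have "(mid_coeff F 1)\<^sup>2 - const_coeff F 1 * sq_coeff F 1
      = 4 * (t * (t - C) * (t - D)) * (F * (F - C) * (F - D))"
    unfolding mid_coeff_def const_coeff_def sq_coeff_def folds
    by (simp add: power2_eq_square algebra_simps)
  also have "\<dots> = (2 * E * (cubic * g))\<^sup>2"
  proof -
    have "(2 * E * (cubic * g))\<^sup>2 = 4 * (E * E) * cubic * (cubic * (g * g))"
      by (simp add: power2_eq_square algebra_simps)
    then show ?thesis unfolding E g2 by (simp add: cub)
  qed
  finally have disc: "(mid_coeff F 1)\<^sup>2 - const_coeff F 1 * sq_coeff F 1 = (2 * E * (cubic * g))\<^sup>2" .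
  have "R\<^sup>2 + const_coeff F 1 * sq_coeff F 1 = 2 * mid_coeff F 1 * R"
    using disc unfolding R by (simp add: power2_eq_square algebra_simps)
  then have "sq_coeff F 1 * (R\<^sup>2 + const_coeff F 1 * sq_coeff F 1) = sq_coeff F 1 * (2 * mid_coeff F 1 * R)"
    by simp
  then show "linked F 1 R (sq_coeff F 1)"
    unfolding linked_def by (simp add: power2_eq_square algebra_simps)
  have "mid_coeff F 1 = F * (F - C) * (F - D) + cubic - (F + t - C - D) * sq_coeff F 1"
    unfolding mid_coeff_def sq_coeff_def folds cub by (simp add: power2_eq_square algebra_simps)
  also have "F * (F - C) * (F - D) = cubic * (g * g)" using g2 by simp
  finally have mid: "mid_coeff F 1 = cubic * (g * g) + cubic - (F + t - C - D) * sq_coeff F 1" .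
  have "cubic * (g - E)\<^sup>2 = cubic * (g * g) - 2 * E * (cubic * g) + cubic * (E * E)"
    by (simp add: power2_eq_square algebra_simps)
  then show "R = cubic * (cubic ^ m - [:e:])\<^sup>2 - (F + [:0, 1:] - [:c:] - [:d:]) * sq_coeff F 1"
    unfolding R mid folds g_def[symmetric] E by (simp add: algebra_simps)
qed

text \<open>
  In the abscissa of the first neighbour, every field element \<open>a\<close> with \<open>f(a)\<^sup>m = e\<close> cancels a factor
  \<open>(t - a)\<^sup>2\<close> and every root \<open>a\<close> of \<open>f\<close> a factor \<open>t - a\<close>. The more such elements there are, the
  smaller is the linear coefficient of the quadratic polynomial in \<open>n\<close> that gives the degrees in the
  chain. As \<open>n\<close> is nonnegative, an upper bound for the degree of this first neighbour suffices.
\<close>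
lemma root_count_bound:
  fixes e :: 'a and n :: nat
  assumes e: "e\<^sup>2 = 1"
  shows "(2 * int (card {a. poly cubic a ^ m = e}) + int (card {a. poly cubic a = 0}) - int CARD('a)) * int n
           \<le> int n * int n + int CARD('a)"
proof -
  define q where "q = CARD('a)"
  define F :: "'a poly" where "F = [:0, 1:] ^ q"
  define R where "R = mid_coeff F 1 - 2 * [:e:] * cubic ^ (m + 1)"
  define S where "S = sq_coeff F 1"
  define T where "T = {a. poly cubic a ^ m = e}"
  define Z where "Z = {a. poly cubic a = 0}"
  define PT where "PT = (\<Prod>a\<in>T. [:- a, 1:])"
  define PZ where "PZ = (\<Prod>a\<in>Z. [:- a, 1:])"
  have q: "q = 2 * m + 1" by (simp add: q_def card_eq)
  have "card {0, 1::'a} \<le> q" unfolding q_def by (intro card_mono) auto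
  then have "m > 0" using q by auto
  have e0: "e \<noteq> 0" using e by auto
  have degF: "degree F = q" by (simp add: F_def degree_power_eq)
  have pole: "pole_at_infinity F 1"
    using degF q by (auto simp: pole_at_infinity_def)
  have link: "linked F 1 R S"
    and R: "R = cubic * (cubic ^ m - [:e:])\<^sup>2 - (F + [:0, 1:] - [:c:] - [:d:]) * S"
    using first_neighbour[OF e] by (simp_all add: F_def R_def S_def q_def)
  have "degree cubic = 3" by (simp add: cubic_def)
  have "degree (2 * [:e:] * cubic ^ (m + 1)) \<le> degree (2 * [:e:]) + degree (cubic ^ (m+1))"
    by (rule degree_mult_le)
  also have "\<dots> = 3 * (m + 1)" using \<open>degree cubic = 3\<close>
    by (subst degree_power_eq) (auto simp: numeral_poly)
  also have "\<dots> \<le> 2 * q + 1" using q \<open>m > 0\<close> by simp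
  finally have degR: "degree R \<le> 2 * q + 1"
    unfolding R_def using degree_coeffs(2)[OF pole] degF by (intro degree_diff_le) auto
  have S0: "S \<noteq> 0"
  proof
    assume "S = 0"
    then have "F = [:0, 1:]" by (simp add: S_def sq_coeff_def)
    then have "degree F = 1" by simp
    then show False using degF q \<open>m > 0\<close> by simp
  qed
  have disj: "T \<inter> Z = {}" using e0 \<open>m > 0\<close> by (auto simp: T_def Z_def)
  have "PT * PZ = (\<Prod>a\<in>T \<union> Z. [:- a, 1:])"
    unfolding PT_def PZ_def using disj by (simp add: prod.union_disjoint)
  also have "\<dots> dvd F - [:0, 1:]"
    by (rule prod_linear_factors_dvd) (auto simp: F_def q_def finite_field_power_card)
  finally have "(PT * PZ)\<^sup>2 dvd S" by (simp add: S_def sq_coeff_def dvd_power_same del: mult_pCons_left)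
  moreover have "PT\<^sup>2 * PZ dvd (PT * PZ)\<^sup>2" by (simp add: power2_eq_square mult_ac)
  ultimately have hS: "PT\<^sup>2 * PZ dvd S" by (rule dvd_trans[rotated])
  have "PT dvd cubic ^ m - [:e:]"
    unfolding PT_def by (rule prod_linear_factors_dvd) (auto simp: T_def)
  moreover have "PZ dvd cubic"
    unfolding PZ_def by (rule prod_linear_factors_dvd) (auto simp: Z_def)
  ultimately have "PT\<^sup>2 * PZ dvd (cubic ^ m - [:e:])\<^sup>2 * cubic"
    by (intro mult_dvd_mono dvd_power_same)
  then have hR: "PT\<^sup>2 * PZ dvd R"
    unfolding R mult.commute[of cubic] using dvd_mult[OF hS] by (rule dvd_diff)
  obtain R' S' where RS': "R = (PT\<^sup>2 * PZ) * R'" "S = (PT\<^sup>2 * PZ) * S'"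
    using hS hR by (auto elim!: dvdE)
  have "S' \<noteq> 0" using S0 RS' by auto
  then obtain g F\<^sub>1 G\<^sub>1 where *: "R' = g * F\<^sub>1" "S' = g * G\<^sub>1" "coprime F\<^sub>1 G\<^sub>1"
    using common_factor_poly by blast
  define h where "h = PT\<^sup>2 * PZ * g"
  have h: "R = h * F\<^sub>1" "S = h * G\<^sub>1" unfolding h_def RS' * by (simp_all add: mult.assoc)
  have h0: "h \<noteq> 0" using h S0 by auto
  have "h\<^sup>2 * (sq_coeff F 1 * F\<^sub>1\<^sup>2 + const_coeff F 1 * G\<^sub>1\<^sup>2) = h\<^sup>2 * (2 * mid_coeff F 1 * F\<^sub>1 * G\<^sub>1)"
    using link unfolding linked_def h by (simp add: power2_eq_square algebra_simps)
  then have link\<^sub>1: "linked F 1 F\<^sub>1 G\<^sub>1" using h0 unfolding linked_def by simp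
  have "G\<^sub>1 \<noteq> 0" using S0 h by auto
  then have "F\<^sub>1 \<noteq> 0" using linked_pole_at_infinity[OF pole link\<^sub>1] by (auto simp: pole_at_infinity_def)
  have nz: "PT \<noteq> 0" "PZ \<noteq> 0" "g \<noteq> 0" using h0 by (auto simp: h_def)
  have "degree R = degree h + degree F\<^sub>1" unfolding h using h0 \<open>F\<^sub>1 \<noteq> 0\<close> by (rule degree_mult_eq)
  moreover have "degree h = 2 * card T + card Z + degree g"
    unfolding h_def using nz
    by (simp add: degree_mult_eq degree_power_eq PT_def PZ_def degree_prod_linear_factors)
  ultimately have "degree F\<^sub>1 + 2 * card T + card Z \<le> 2 * q + 1" using degR by simp
  then have "(int (degree F\<^sub>1) - int q - 1) * int n \<le> (int q - 2 * int (card T) - int (card Z)) * int n"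
    by (intro mult_right_mono) auto
  moreover have "0 \<le> int n * int n + (int (degree F\<^sub>1) - int q - 1) * int n + int q"
    using degree_quadratic_nonneg[OF _ pole *(3) link\<^sub>1, of n] degF by simp
  ultimately show ?thesis unfolding T_def Z_def q_def by (simp add: algebra_simps)
qed

end

section \<open>The quadratic character\<close>

definition qchar :: "'a::field \<Rightarrow> int" where
  "qchar x = (if x = 0 then 0 else if \<exists>y. y\<^sup>2 = x then 1 else - 1)"

lemma qchar_0 [simp]: "qchar 0 = 0"
  and qchar_1 [simp]: "qchar 1 = 1"
  by (auto simp: qchar_def intro: exI[of _ 1])

lemma qchar_cases: "x \<noteq> 0 \<Longrightarrow> qchar x = 1 \<or> qchar x = -1"
  by (simp add: qchar_def)

lemma card_square_roots_le:
  "card {x. x\<^sup>2 = (y::'a::field)} \<le> 2"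
proof (cases "\<exists>x. x\<^sup>2 = y")
  case True
  then obtain x where "x\<^sup>2 = y" by blast
  then have "{x. x\<^sup>2 = y} = {x, - x}" by (auto simp: power2_eq_iff)
  then show ?thesis by (simp add: card_insert_if)
qed auto

lemma card_square_roots:
  assumes "(2::'a::field) \<noteq> 0"
  shows "int (card {x. x\<^sup>2 = (y::'a)}) = 1 + qchar y"
proof (cases "\<exists>x. x\<^sup>2 = y")
  case True
  then obtain x where x: "x\<^sup>2 = y" by blast
  then have eq: "{x. x\<^sup>2 = y} = {x, - x}" by (auto simp: power2_eq_iff)
  have "x = - x \<longleftrightarrow> x = 0" using assms
    by (metis add.right_neutral add_cancel_right_right double_zero_sym eq_neg_iff_add_eq_0 mult_2 mult_eq_0_iff)
  then show ?thesis unfolding eq using x by (auto simp: qchar_def card_insert_if)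
next
  case False
  then show ?thesis by (auto simp: qchar_def)
qed

text \<open>
  The nonzero squares are roots of \<open>x\<^sup>m - 1\<close> with \<open>m = (q - 1) / 2\<close>, which has at most \<open>m\<close> roots; and there are at least \<open>m\<close>
  nonzero squares, because squaring is at most two-to-one on \<open>2 m\<close> elements.
\<close>
lemma euler_criterion:
  fixes x :: "'a::{field,finite}"
  assumes "odd CARD('a)"
  shows "x ^ (CARD('a) div 2) = of_int (qchar x)"
proof -
  define m where "m = CARD('a) div 2"
  have card_eq: "CARD('a) = 2 * m + 1" using assms by (simp add: m_def)
  have "card {0, 1::'a} \<le> CARD('a)" by (intro card_mono) auto
  then have "m > 0" using card_eq by auto
  define Q where "Q = (\<lambda>x::'a. x\<^sup>2) ` (- {0})"
  define E where "E = {x::'a. x ^ m = 1}"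
  have fermat: "(x\<^sup>2) ^ m = 1" if "x \<noteq> 0" for x :: 'a
    using finite_field_power_card_minus_one[OF that] by (simp add: card_eq power_mult)
  have "card E \<le> m"
  proof -
    have deg: "degree (monom 1 m - 1 :: 'a poly) = m"
      using \<open>m > 0\<close> degree_add_eq_left[of "- 1" "monom 1 m :: 'a poly"] by (simp add: degree_monom_eq)
    then have "monom 1 m - 1 \<noteq> (0 :: 'a poly)" using \<open>m > 0\<close> by force
    then have "card {x. poly (monom 1 m - 1 :: 'a poly) x = 0} \<le> m"
      using card_poly_roots_bound deg by metis
    then show ?thesis by (simp add: E_def poly_monom)
  qed
  also have "m \<le> card Q"
  proof -
    have "2 * m = card (- {0::'a})"
      by (simp add: Compl_eq_Diff_UNIV card_Diff_singleton card_eq)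
    also have "\<dots> \<le> card (\<Union>y\<in>Q. {x. x\<^sup>2 = y})"
      by (intro card_mono) (auto simp: Q_def)
    also have "\<dots> \<le> (\<Sum>y\<in>Q. card {x. x\<^sup>2 = y})" by (rule card_UN_le) simp
    also have "\<dots> \<le> (\<Sum>y\<in>Q. 2)" by (intro sum_mono card_square_roots_le)
    finally show ?thesis by simp
  qed
  finally have "Q = E"
    by (intro card_seteq) (auto simp: Q_def E_def fermat)
  have "qchar x = 1 \<longleftrightarrow> x ^ m = 1" if "x \<noteq> 0"
  proof -
    have "qchar x = 1 \<longleftrightarrow> x \<in> Q" using that by (auto simp: qchar_def Q_def)
    then show ?thesis using \<open>Q = E\<close> by (simp add: E_def)
  qed
  moreover have "x ^ m = 1 \<or> x ^ m = - 1" if "x \<noteq> 0"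
  proof -
    have "(x ^ m)\<^sup>2 = 1" using fermat[OF that] by (simp add: power_mult[symmetric] mult.commute)
    then show ?thesis by (simp add: power2_eq_1_iff)
  qed
  ultimately show ?thesis
    using qchar_cases[of x] \<open>m > 0\<close> unfolding m_def[symmetric] by (cases "x = 0") auto
qed

lemma of_int_sign_inject:
  assumes "(2::'a::field) \<noteq> 0" "i \<in> {-1, 0, 1}" "j \<in> {-1, 0, 1}" "of_int i = (of_int j :: 'a)"
  shows "i = j"
proof -
  have "(1::'a) \<noteq> - 1" using assms(1) by (simp add: eq_neg_iff_add_eq_0)
  then show ?thesis using assms(2-4) by (auto dest: sym)
qed

lemma qchar_range: "qchar x \<in> {-1, 0, 1}"
  by (simp add: qchar_def)

lemma qchar_mult:
  fixes x y :: "'a::{field,finite}"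
  assumes "odd CARD('a)"
  shows "qchar (x * y) = qchar x * qchar y"
proof (rule of_int_sign_inject[where 'a = 'a])
  show "qchar x * qchar y \<in> {-1, 0, 1}"
    using qchar_range[of x] qchar_range[of y] by auto
  show "of_int (qchar (x * y)) = (of_int (qchar x * qchar y) :: 'a)"
    by (simp add: euler_criterion[OF assms, symmetric] power_mult_distrib)
qed (use two_neq_zero_of_odd_card[OF assms] qchar_range in auto)

text \<open>Group the elements \<open>t\<close> by their square \<open>u\<close>, which has \<open>1 + qchar u\<close> roots.\<close>
lemma sum_of_square:
  fixes g :: "'a::{field,finite} \<Rightarrow> int"
  assumes "odd CARD('a)"
  shows "(\<Sum>t\<in>UNIV. g (t\<^sup>2)) = (\<Sum>u\<in>UNIV. (1 + qchar u) * g u)"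
proof -
  have "(\<Sum>t\<in>UNIV. g (t\<^sup>2)) = (\<Sum>u\<in>UNIV. \<Sum>t\<in>{t\<in>UNIV. t\<^sup>2 = u}. g (t\<^sup>2))"
    by (rule sum.group[symmetric]) auto
  also have "\<dots> = (\<Sum>u\<in>UNIV. (1 + qchar u) * g u)"
    by (simp add: card_square_roots[OF two_neq_zero_of_odd_card[OF assms], symmetric])
  finally show ?thesis .
qed

lemma sum_qchar:
  assumes "odd CARD('a::{field,finite})"
  shows "(\<Sum>x::'a\<in>UNIV. qchar x) = 0"
  using sum_of_square[OF assms, of "\<lambda>_. 1"] by (simp add: sum.distrib)

text \<open>
  After a shift the argument is \<open>u (u + e) = u\<^sup>2 (1 + e / u)\<close>, and \<open>1 + e / u\<close> runs through all elements
  except 1.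
\<close>
lemma sum_qchar_split_quadratic:
  fixes c d :: "'a::{field,finite}"
  assumes odd: "odd CARD('a)" and "c \<noteq> d"
  shows "(\<Sum>u\<in>UNIV. qchar ((u - c) * (u - d))) = -1"
proof -
  define e where "e = c - d"
  have e: "e \<noteq> 0" using assms by (simp add: e_def)
  have "(\<Sum>u\<in>UNIV. qchar ((u - c) * (u - d))) = (\<Sum>u\<in>UNIV. qchar (u * (u + e)))"
    by (rule sum.reindex_bij_witness[where i = "\<lambda>u. u + c" and j = "\<lambda>u. u - c"])
       (auto simp: e_def)
  also have "\<dots> = (\<Sum>u\<in>-{0}. qchar (u * (u + e)))"
    by (rule sum.mono_neutral_right) auto
  also have "\<dots> = (\<Sum>u\<in>-{0}. qchar (1 + e / u))"
  proof (rule sum.cong)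
    fix u :: 'a assume "u \<in> - {0}"
    then have u: "u \<noteq> 0" by simp
    then have "u * (u + e) = u * u * (1 + e / u)" by (simp add: field_simps)
    moreover have "qchar u * qchar u = 1" using qchar_cases[OF u] by auto
    ultimately show "qchar (u * (u + e)) = qchar (1 + e / u)"
      by (simp only: qchar_mult[OF odd])
  qed simp
  also have "\<dots> = (\<Sum>v::'a\<in>-{1}. qchar v)"
    by (rule sum.reindex_bij_witness[where i = "\<lambda>v. e / (v - 1)" and j = "\<lambda>u. 1 + e / u"])
       (use e in auto)
  also have "\<dots> = (\<Sum>v::'a\<in>UNIV. qchar v) - 1"
    by (simp add: Compl_eq_Diff_UNIV sum_diff1)
  finally show ?thesis using sum_qchar[OF odd] by simp
qed

section \<open>The Hasse bound\<close>

text \<open>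
  The two choices \<open>e = 1\<close> and \<open>e = -1\<close> of the first neighbour give \<open>\<bar>S\<bar> n \<le> n\<^sup>2 + q\<close> for all natural
  \<open>n\<close>, where \<open>S\<close> is the character sum. The best \<open>n\<close> is \<open>\<bar>S\<bar> / 2\<close>, rounded down. For odd \<open>S\<close> the rounding
  costs 1, which is recovered because \<open>q\<close> is odd and \<open>k (k + 1)\<close> is even.
\<close>
theorem hasse_bound_full_two_torsion:
  fixes c d :: "'a::{field,finite}"
  assumes odd: "odd CARD('a)" and c: "c \<noteq> 0" and d: "d \<noteq> 0" and cd: "c \<noteq> d"
  shows "(\<Sum>u\<in>UNIV. qchar (u * (u - c) * (u - d)))\<^sup>2 \<le> 4 * int CARD('a)"
proof -
  define m where "m = CARD('a) div 2"
  define S where "S = (\<Sum>u\<in>UNIV. qchar (u * (u - c) * (u - d)))"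
  interpret cubic_over_finite_field c d m
    using assms two_neq_zero_of_odd_card[OF odd] by unfold_locales (simp_all add: m_def)
  define T where "T = (\<lambda>e. {u. poly cubic u ^ m = e})"
  define Z where "Z = {u. poly cubic u = 0}"
  have "card {0, 1::'a} \<le> CARD('a)" by (intro card_mono) auto
  then have "m > 0" using card_eq by auto
  have ne: "(1::'a) \<noteq> - 1" using two_nonzero by (simp add: eq_neg_iff_add_eq_0)
  have cub: "poly cubic u = u * (u - c) * (u - d)" for u by (simp add: cubic_def algebra_simps)
  have euler: "poly cubic u ^ m = of_int (qchar (poly cubic u))" for u
    unfolding m_def by (rule euler_criterion[OF odd])
  have *: "qchar (poly cubic u) = of_bool (u \<in> T 1) - of_bool (u \<in> T (- 1))"
    "1 = of_bool (u \<in> T 1) + of_bool (u \<in> T (- 1)) + (of_bool (u \<in> Z) :: int)" for u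
    using qchar_cases[of "poly cubic u"] ne unfolding T_def Z_def mem_Collect_eq euler
    by (cases "poly cubic u = 0"; force)+
  have S: "S = int (card (T 1)) - int (card (T (- 1)))"
    unfolding S_def cub[symmetric] *(1) by (simp add: sum_subtractf)
  have "int CARD('a) = (\<Sum>u::'a\<in>UNIV. 1)" by simp
  also have "\<dots> = (\<Sum>u\<in>UNIV. of_bool (u \<in> T 1) + of_bool (u \<in> T (- 1)) + of_bool (u \<in> Z))"
    by (intro sum.cong refl *(2))
  also have "\<dots> = int (card (T 1)) + int (card (T (- 1))) + int (card Z)"
    by (simp add: sum.distrib)
  finally have q: "int CARD('a) = int (card (T 1)) + int (card (T (- 1))) + int (card Z)" .
  have T: "card {u. poly cubic u ^ m = e} = card (T e)" for e by (simp add: T_def)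
  have "2 * int (card (T 1)) + int (card Z) - int CARD('a) = S"
    "2 * int (card (T (- 1))) + int (card Z) - int CARD('a) = - S" using S q by simp_all
  then have "S * int n \<le> int n * int n + int CARD('a)"
    and "- S * int n \<le> int n * int n + int CARD('a)" for n
    using root_count_bound[of 1 n] root_count_bound[of "-1" n]
    unfolding T Z_def[symmetric] by simp_all
  then have bound: "\<bar>S\<bar> * int n \<le> int n * int n + int CARD('a)" for n
    by (cases "S \<ge> 0") simp_all
  define k where "k = nat (\<bar>S\<bar> div 2)"
  have k: "int k = \<bar>S\<bar> div 2" by (simp add: k_def)
  have "S\<^sup>2 \<le> 4 * int CARD('a)"
  proof (cases "even S")
    case True
    then have S: "\<bar>S\<bar> = 2 * int k" using k by simp
    then have "int k * int k \<le> int CARD('a)" using bound[of k] by simp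
    moreover have "S\<^sup>2 = 4 * (int k * int k)"
      unfolding power2_abs[of S, symmetric] S by (simp add: power2_eq_square)
    ultimately show ?thesis by simp
  next
    case False
    then have S: "\<bar>S\<bar> = 2 * int k + 1" using k by (simp add: odd_two_times_div_two_succ)
    then have "int (k * (k + 1)) \<le> int CARD('a)" using bound[of k] by (simp add: algebra_simps)
    moreover have "k * (k + 1) \<noteq> CARD('a)"
    proof
      assume "k * (k + 1) = CARD('a)"
      then have "even CARD('a)" by (metis even_mult_iff even_plus_one_iff)
      then show False using odd by simp
    qed
    ultimately have "int (k * (k + 1)) + 1 \<le> int CARD('a)" by linarith
    moreover have "S\<^sup>2 = 4 * int (k * (k + 1)) + 1"
      unfolding power2_abs[of S, symmetric] S by (simp add: power2_eq_square algebra_simps)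
    ultimately show ?thesis by simp
  qed
  then show ?thesis by (simp add: S_def)
qed

section \<open>Counting the union\<close>

text \<open>
  The equation \<open>t = a x + N / x\<close> is quadratic in \<open>x\<close> with discriminant \<open>t\<^sup>2 - 4 a N\<close>; a root is nonzero
  since \<open>N\<close> is.
\<close>
lemma mem_H_set_iff:
  assumes two: "(2::'a::field) \<noteq> 0" and a: "a \<noteq> 0" and N: "N \<noteq> 0"
  shows "t \<in> H_set a N \<longleftrightarrow> (\<exists>y. y\<^sup>2 = t\<^sup>2 - 4 * a * (N::'a))"
proof
  assume "t \<in> H_set a N"
  then obtain x where x: "x \<noteq> 0" "t = a * x + N * inverse x" by (auto simp: H_set_def)
  have "(a * x - N * inverse x)\<^sup>2 = t\<^sup>2 - 4 * a * N"
    unfolding x(2) using x(1) by (simp add: power2_eq_square field_simps)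
  then show "\<exists>y. y\<^sup>2 = t\<^sup>2 - 4 * a * N" by blast
next
  assume "\<exists>y. y\<^sup>2 = t\<^sup>2 - 4 * a * N"
  then obtain y where y: "y\<^sup>2 = t\<^sup>2 - 4 * a * N" by blast
  have "4 * a * N = (t - y) * (t + y)" using y by (simp add: power2_eq_square algebra_simps)
  moreover have "(4::'a) \<noteq> 0" using two no_zero_divisors[of "2::'a" 2] by simp
  ultimately have ty: "t + y \<noteq> 0" and prod: "(t - y) * (t + y) = 4 * a * N" using a N by auto
  define x where "x = (t + y) / (2 * a)"
  have "x \<noteq> 0" using ty two a by (simp add: x_def)
  have "N * inverse x = (2 * a * N) / (t + y)"
    by (simp add: x_def)
  also have "\<dots> = (t - y) / 2"
  proof -
    have "2 * a * N * 2 = (t - y) * (t + y)" using prod by (simp add: mult_ac)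
    then show ?thesis using ty two by (simp only: frac_eq_eq not_False_eq_True)
  qed
  finally have "a * x + N * inverse x = (t + y) / 2 + (t - y) / 2" using a by (simp add: x_def)
  also have "\<dots> = t" using two by (simp add: field_simps)
  finally show "t \<in> H_set a N" using \<open>x \<noteq> 0\<close> unfolding H_set_def by force
qed

text \<open>
  The weight \<open>(1 - qchar (t\<^sup>2 - c)) (1 - qchar (t\<^sup>2 - d))\<close> is 4 on \<open>M\<close>, and off \<open>M\<close> it vanishes unless
  \<open>t\<^sup>2\<close> is \<open>c\<close> or \<open>d\<close>. Those at most four exceptional \<open>t\<close> have a weight between 0 and 2 and account for
  the gap of 8 between the bounds. The total weight is evaluated by substituting \<open>u = t\<^sup>2\<close>.
\<close>
lemma card_both_nonsquare:
  fixes c d :: "'a::{field,finite}"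
  assumes odd: "odd CARD('a)" and c: "c \<noteq> 0" and d: "d \<noteq> 0" and cd: "c \<noteq> d"
  defines "M \<equiv> {t. (\<nexists>y. y\<^sup>2 = t\<^sup>2 - c) \<and> (\<nexists>y. y\<^sup>2 = t\<^sup>2 - d)}"
    and "S \<equiv> (\<Sum>u\<in>UNIV. qchar (u * (u - c) * (u - d)))"
  shows "4 * int (card M) \<le> int CARD('a) + 1 + S"
    and "int CARD('a) + 1 + S \<le> 4 * int (card M) + 8"
proof -
  define w where "w = (\<lambda>t. (1 - qchar (t\<^sup>2 - c)) * (1 - qchar (t\<^sup>2 - d)))"
  define B where "B = {t. t\<^sup>2 = c} \<union> {t. t\<^sup>2 = d}"
  note mult = qchar_mult[OF odd]
  have lin: "(\<Sum>t\<in>UNIV. qchar (t\<^sup>2 - b)) = -1" if "b \<noteq> 0" for b :: 'a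
  proof -
    have "(\<Sum>t\<in>UNIV. qchar (t\<^sup>2 - b)) = (\<Sum>u\<in>UNIV. qchar (u - b)) + (\<Sum>u\<in>UNIV. qchar ((u - 0) * (u - b)))"
      by (subst sum_of_square[OF odd]) (simp add: mult distrib_right sum.distrib)
    also have "(\<Sum>u\<in>UNIV. qchar (u - b)) = (\<Sum>u::'a\<in>UNIV. qchar u)"
      by (rule sum.reindex_bij_witness[where i = "\<lambda>u. u + b" and j = "\<lambda>u. u - b"]) auto
    finally show ?thesis
      using sum_qchar[OF odd] sum_qchar_split_quadratic[OF odd, of 0 b] that by simp
  qed
  have quad: "(\<Sum>t\<in>UNIV. qchar (t\<^sup>2 - c) * qchar (t\<^sup>2 - d)) = -1 + S"
  proof -
    have "(\<Sum>t\<in>UNIV. qchar (t\<^sup>2 - c) * qchar (t\<^sup>2 - d))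
        = (\<Sum>u\<in>UNIV. qchar ((u - c) * (u - d))) + S"
      by (subst sum_of_square[OF odd, of "\<lambda>u. qchar (u - c) * qchar (u - d)"])
         (simp add: S_def mult distrib_right sum.distrib mult.assoc)
    then show ?thesis using sum_qchar_split_quadratic[OF odd cd] by simp
  qed
  have "(\<Sum>t\<in>UNIV. w t) = int CARD('a) - (\<Sum>t\<in>UNIV. qchar (t\<^sup>2 - c)) - (\<Sum>t\<in>UNIV. qchar (t\<^sup>2 - d))
      + (\<Sum>t\<in>UNIV. qchar (t\<^sup>2 - c) * qchar (t\<^sup>2 - d))"
    by (simp add: w_def ring_distribs sum.distrib sum_subtractf)
  then have total: "(\<Sum>t\<in>UNIV. w t) = int CARD('a) + 1 + S" using lin[OF c] lin[OF d] quad by simp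
  have "w t = 4 * of_bool (t \<in> M) + of_bool (t \<in> B) * w t" for t
    by (auto simp: w_def M_def B_def qchar_def)
  then have "(\<Sum>t\<in>UNIV. w t) = (\<Sum>t\<in>UNIV. 4 * of_bool (t \<in> M) + of_bool (t \<in> B) * w t)"
    by (intro sum.cong) auto
  also have "\<dots> = 4 * int (card M) + (\<Sum>t\<in>B. w t)"
  proof -
    have "(\<Sum>t\<in>UNIV. of_bool (t \<in> B) * w t) = (\<Sum>t\<in>B. w t)"
      by (rule sum.mono_neutral_cong_right) auto
    then show ?thesis by (simp add: sum.distrib sum_distrib_left[symmetric])
  qed
  finally have split: "(\<Sum>t\<in>UNIV. w t) = 4 * int (card M) + (\<Sum>t\<in>B. w t)" .
  have w: "0 \<le> w t \<and> w t \<le> 2" if "t \<in> B" for t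
    using that by (auto simp: w_def B_def qchar_def)
  have "(\<Sum>t\<in>B. w t) \<le> (\<Sum>t\<in>B. 2)" using w by (intro sum_mono) auto
  moreover have "card B \<le> 4"
    unfolding B_def by (rule order.trans[OF card_Un_le])
      (use card_square_roots_le[of c] card_square_roots_le[of d] in linarith)
  ultimately have "(\<Sum>t\<in>B. w t) \<le> 8" by simp
  moreover have "(\<Sum>t\<in>B. w t) \<ge> 0" using w by (intro sum_nonneg) auto
  ultimately show "4 * int (card M) \<le> int CARD('a) + 1 + S"
    and "int CARD('a) + 1 + S \<le> 4 * int (card M) + 8"
    using total split by linarith+
qed

theorem corollary6p6:
  fixes l :: nat and a b N :: "'a::{field,finite}"
  assumes "prime l" and "l > 2" and "CARD('a) = l"
    and "N \<noteq> 0" and "a \<noteq> 0" and "b \<noteq> 0" and "a \<noteq> b"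
  shows "\<bar>real (card (U_set a b N)) - 3 * real l / 4\<bar> \<le> (2 * sqrt (real l) + 7) / 4"
proof -
  have odd: "odd CARD('a)" using assms prime_odd_nat by simp
  have two: "(2::'a) \<noteq> 0" by (rule two_neq_zero_of_odd_card[OF odd])
  then have four: "(4::'a) \<noteq> 0" using no_zero_divisors[of "2::'a" 2] by simp
  define c where "c = 4 * a * N"
  define d where "d = 4 * b * N"
  have cd: "c \<noteq> 0" "d \<noteq> 0" "c \<noteq> d" using four assms by (simp_all add: c_def d_def)
  define M where "M = {t. (\<nexists>y. y\<^sup>2 = t\<^sup>2 - c) \<and> (\<nexists>y. y\<^sup>2 = t\<^sup>2 - d)}"
  define S where "S = (\<Sum>u\<in>UNIV. qchar (u * (u - c) * (u - d)))"
  have "U_set a b N = - M"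
    using two assms by (auto simp: U_set_def M_def c_def d_def mem_H_set_iff)
  then have "card (U_set a b N) = l - card M"
    using assms by (simp add: Compl_eq_Diff_UNIV card_Diff_subset)
  moreover have "card M \<le> l" using assms(3) by (metis card_mono finite subset_UNIV)
  ultimately have U: "real (card (U_set a b N)) = real l - real (card M)" by simp
  have "4 * int (card M) \<le> int l + 1 + S" "int l + 1 + S \<le> 4 * int (card M) + 8"
    using card_both_nonsquare[OF odd cd] assms(3) by (simp_all add: M_def S_def)
  then have "real_of_int (4 * int (card M)) \<le> real_of_int (int l + 1 + S)"
    "real_of_int (int l + 1 + S) \<le> real_of_int (4 * int (card M) + 8)"
    by (simp_all only: of_int_le_iff)
  moreover have "\<bar>real_of_int S\<bar> \<le> 2 * sqrt (real l)"
  proof -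
    have "S\<^sup>2 \<le> 4 * int l" using hasse_bound_full_two_torsion[OF odd cd] assms(3) by (simp add: S_def)
    then have "real_of_int (S\<^sup>2) \<le> real_of_int (4 * int l)" by (simp only: of_int_le_iff)
    then have "sqrt ((real_of_int S)\<^sup>2) \<le> sqrt (4 * real l)" by (intro real_sqrt_le_mono) simp
    then show ?thesis by (simp add: real_sqrt_mult)
  qed
  ultimately show ?thesis unfolding U abs_le_iff by (auto simp: field_simps)
qed

end
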